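(* Fix $c>1$. Any randomized cell-probe data structure that solves $(c,r)$-ANN on the Hamming random instance (defined in the context) with success probability at least $2/3$, uses memory cells of $w=n^{o(1)}$ bits, and reads a single cell per query, must use at least $n^{\left(\frac{c}{c-1}\right)^2-o(1)}$ cells, where $o(1)\to0$ as $n\to\infty$.
   Context: Hamming random instance with parameters $n,c$ and $d=\omega(\log n)$: the dataset $P\subset\{-1,1\}^d$ consists of $n$ points drawn independently and uniformly from $\{-1,1\}^d$; the query $q$ is obtained by choosing $p\in P$ uniformly at random and flipping each coordinate of $p$ independently with probability $\frac{1}{2c}$. With high probability $\|p-q\|_1\le r:=(1+o(1))\frac{d}{2c}$ (Hamming distance) while every other data point is at Hamming distance at least $(1-o(1))\frac d2$ from $q$. Solving $(c,r)$-ANN on this instance means returning the planted point $p$ (with probability taken over the instance and the data structure's randomness). Cell-probe model: the data structure is a table of cells of $w$ bits each computed from $P$; the query algorithm's cost is the number of cells it reads, and space is the number of cells. *)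

theory Defs
  imports "HOL-Probability.Probability"
begin

text \<open>Points of the Hamming cube: a point of the cube of dimension d is a function
  nat to int with values in {-1,1} on coordinates 0..d-1 and value 0 elsewhere.
  A dataset of n points is a function nat to point, indexed by 0..n-1.\<close>

type_synonym point = "nat \<Rightarrow> int"
type_synonym dataset = "nat \<Rightarrow> point"

definition rand_point :: "nat \<Rightarrow> point pmf" where
  "rand_point d = Pi_pmf {..<d} 0 (\<lambda>_. pmf_of_set {-1, 1})"

definition noisy_copy :: "real \<Rightarrow> nat \<Rightarrow> point \<Rightarrow> point pmf" where
  "noisy_copy c d p = Pi_pmf {..<d} 0
     (\<lambda>j. map_pmf (\<lambda>b. if b then - p j else p j) (bernoulli_pmf (1 / (2 * c))))"

definition hamming_instance :: "nat \<Rightarrow> real \<Rightarrow> nat \<Rightarrow> (dataset \<times> nat \<times> point) pmf" where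
  "hamming_instance n c d =
     bind_pmf (Pi_pmf {..<n} (\<lambda>_. 0) (\<lambda>_. rand_point d)) (\<lambda>P.
     bind_pmf (pmf_of_set {..<n}) (\<lambda>i.
     bind_pmf (noisy_copy c d (P i)) (\<lambda>q.
     return_pmf (P, i, q))))"

text \<open>A randomized one-probe cell-probe data structure, with public random string
  r drawn from the pmf R: the table tbl r P maps each cell index to its content
  (a w-bit word, encoded as a natural number below 2^w); the query reads the single cell
  prb r q and outputs the point ans r q (content of that cell).\<close>
definition one_probe_ds ::
  "'r pmf \<Rightarrow> nat \<Rightarrow> nat \<Rightarrow> ('r \<Rightarrow> dataset \<Rightarrow> nat \<Rightarrow> nat) \<Rightarrow> ('r \<Rightarrow> point \<Rightarrow> nat)
     \<Rightarrow> bool" where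
  "one_probe_ds R S w tbl prb \<longleftrightarrow>
     (\<forall>r\<in>set_pmf R. (\<forall>q. prb r q < S) \<and> (\<forall>P j. tbl r P j < 2 ^ w))"

definition success_prob ::
  "'r pmf \<Rightarrow> ('r \<Rightarrow> dataset \<Rightarrow> nat \<Rightarrow> nat) \<Rightarrow> ('r \<Rightarrow> point \<Rightarrow> nat)
     \<Rightarrow> ('r \<Rightarrow> point \<Rightarrow> nat \<Rightarrow> point) \<Rightarrow> (dataset \<times> nat \<times> point) pmf \<Rightarrow> real" where
  "success_prob R tbl prb ans I =
     measure_pmf.prob (pair_pmf R I)
       {(r, P, i, q). ans r q (tbl r P (prb r q)) = P i}"

end

theory Submission
  imports Defs "HOL-Real_Asymp.Real_Asymp"
begin

text \<open>
  Fix the random string. Let Q(j) be the set of queries that probe cell j, b(j) its uniform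
  measure, and g(j) the image of its indicator under the noise operator, so that g(j)(p) is the
  probability that a noisy copy of p probes cell j. Hypercontractivity with correlation
  \<open>\<rho> = 1 - 1/c\<close> gives \<open>E g(j)^s \<le> b(j)^(s/q)\<close> whenever \<open>\<rho>^2 (s - 1) = q - 1\<close> and \<open>1 < q \<le> s \<le> 2\<close>.

  A word of w bits can serve essentially only w dataset points. Let h be the probability that a
  noisy copy of p probes cell j and is answered with p; a query has only one answer, so the
  mean of h is b(j) times a quantity that vanishes with d. Truncate h at a level \<open>\<theta>\<close>. An exponential
  moment bound over the \<open>2^w\<close> possible contents shows that the truncated part contributes about
  \<open>\<theta> w\<close>, and the part above \<open>\<theta>\<close> is at most \<open>n \<theta>^(1 - s) E g(j)^s\<close>.
  Optimising \<open>\<theta>\<close> and summing over the S cells bounds the success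
  probability by \<open>o(1) + 4 ((w + 1)/n)^(1 - 1/s) S^(1 - 1/q)\<close>. The resulting exponent
  \<open>(1 - 1/s)/(1 - 1/q)\<close> tends to \<open>1/\<rho>^2\<close> as s tends to 1.
\<close>

section \<open>Two-point hypercontractivity\<close>

text \<open>From the third one on, the factors of the falling factorial are negated. For
  \<open>a \<le> 2\<close> they are then nonnegative and decrease in \<open>a\<close>, which makes
  coefficients with different upper arguments comparable.\<close>

lemma gbinomial_split_two:
  "(a gchoose (m + 2)) * fact (m + 2) = a * (a - 1) * (-1) ^ m * (\<Prod>i<m. real i + 2 - a)"
  for a :: real
proof (induction m)
  case 0
  show ?case by (simp add: numeral_2_eq_2 gbinomial_prod_rev)
next
  case (Suc m)
  have eq: "(a gchoose k) * fact k = (\<Prod>i<k. a - real i)" for k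
    by (simp add: gbinomial_prod_rev atLeast0LessThan)
  have "(a gchoose (Suc m + 2)) * fact (Suc m + 2) = (a - real (m + 2)) * ((a gchoose (m + 2)) * fact (m + 2))"
    unfolding eq by simp
  then show ?case
    by (simp only: Suc.IH) (simp add: algebra_simps)
qed

text \<open>For even \<open>n\<close> the sign in the factorization is positive. The relation
  between \<rho>, \<open>s\<close> and \<open>q\<close> spends two powers of \<rho> on turning
  \<open>s - 1\<close> into \<open>q - 1\<close>, the factor \<open>q / s\<close> turns
  \<open>s\<close> into \<open>q\<close>, and what remains is
  \<open>\<rho> ^ m * F s \<le> F q\<close>.\<close>

lemma gbinomial_even_le:
  fixes q s \<rho> :: real
  assumes q: "1 < q" "q \<le> s" "s \<le> 2" and \<rho>: "0 \<le> \<rho>" "\<rho> \<le> 1" "\<rho>\<^sup>2 * (s - 1) = q - 1"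
    and n: "even n" "n \<ge> 2"
  shows "(q / s) * (s gchoose n) * \<rho> ^ n \<le> (q gchoose n)"
proof -
  obtain m where m: "n = m + 2" "even m" using n by (metis even_add even_numeral le_Suc_ex add.commute)
  define F where "F a = (\<Prod>i<m. real i + 2 - a)" for a
  have F0: "0 \<le> F s" unfolding F_def using q by (intro prod_nonneg) auto
  have Fle: "F s \<le> F q" unfolding F_def using q by (intro prod_mono) auto
  have eq: "(a gchoose n) * fact n = a * (a - 1) * F a" for a :: real
    using gbinomial_split_two[of a m] m by (simp add: F_def)
  have r: "(s - 1) * \<rho> ^ n = (q - 1) * \<rho> ^ m"
    using \<rho>(3) by (simp add: m power_add power2_eq_square mult_ac)
  have e1: "(q / s) * (s gchoose n) * \<rho> ^ n * fact n = q * (q - 1) * (\<rho> ^ m * F s)"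
  proof -
    have "(q / s) * (s gchoose n) * \<rho> ^ n * fact n = (q / s) * \<rho> ^ n * ((s gchoose n) * fact n)" by simp
    also have "\<dots> = q * ((s - 1) * \<rho> ^ n) * F s" unfolding eq using q by simp
    finally show ?thesis unfolding r by simp
  qed
  have "\<rho> ^ m * F s \<le> 1 * F q"
    using F0 Fle \<rho> by (intro mult_mono power_le_one) auto
  then have "q * (q - 1) * (\<rho> ^ m * F s) \<le> q * (q - 1) * F q"
    using q by (intro mult_left_mono) auto
  then have "(q / s) * (s gchoose n) * \<rho> ^ n * fact n \<le> (q gchoose n) * fact n"
    unfolding e1 eq .
  then show "(q / s) * (s gchoose n) * \<rho> ^ n \<le> (q gchoose n)"
    by (rule mult_right_le_imp_le) simp
qed

text \<open>The powers of 1 + y and 1 - y are expanded as binomial series and compared term by term.\<close>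
lemma two_point_normalized:
  fixes q s \<rho> y :: real
  assumes q: "1 < q" "q \<le> s" "s \<le> 2" and \<rho>: "0 \<le> \<rho>" "\<rho> \<le> 1" "\<rho>\<^sup>2 * (s - 1) = q - 1"
    and y: "\<bar>y\<bar> < 1"
  shows "((1 + \<rho> * y) powr s + (1 - \<rho> * y) powr s) / 2
    \<le> (((1 + y) powr q + (1 - y) powr q) / 2) powr (s / q)"
proof -
  define H where "H = ((1 + \<rho> * y) powr s + (1 - \<rho> * y) powr s) / 2"
  define G where "G = ((1 + y) powr q + (1 - y) powr q) / 2"
  have \<rho>y: "\<bar>\<rho> * y\<bar> < 1"
    using \<rho> y by (simp add: abs_mult) (meson abs_ge_zero le_less_trans mult_left_le_one_le)
  have ev: "(\<lambda>n. (a gchoose n) * (z ^ n + (-z) ^ n) / 2) sums (((1 + z) powr a + (1 - z) powr a) / 2)"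
    if "\<bar>z\<bar> < 1" for a z :: real
    using sums_divide[OF sums_add[OF gen_binomial_real[of z a] gen_binomial_real[of "-z" a]], of 2] that
    by (simp add: algebra_simps)
  have delta: "(\<lambda>n. if n = 0 then c else 0) sums c" for c :: real
    using sums_single[of 0 "\<lambda>_. c"] by simp
  \<comment> \<open>At \<open>n = 0\<close> the scaled series contributes only \<open>q / s\<close>.
    The correction \<open>1 - q / s\<close> brings this to 1, the constant term of the other series,
    so the termwise comparison holds there as well.\<close>
  have "(\<lambda>n. (q / s) * ((s gchoose n) * ((\<rho> * y) ^ n + (-(\<rho> * y)) ^ n) / 2) + (if n = 0 then 1 - q / s else 0))
      sums ((q / s) * H + (1 - q / s))"
    unfolding H_def by (intro sums_add sums_mult ev \<rho>y delta)
  moreover have "(\<lambda>n. (q gchoose n) * (y ^ n + (-y) ^ n) / 2) sums G"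
    unfolding G_def by (intro ev y)
  moreover have "(q / s) * ((s gchoose n) * ((\<rho> * y) ^ n + (-(\<rho> * y)) ^ n) / 2) + (if n = 0 then 1 - q / s else 0)
      \<le> (q gchoose n) * (y ^ n + (-y) ^ n) / 2" for n
  proof (cases "even n")
    case False
    then have "n \<noteq> 0" by (metis even_zero)
    then show ?thesis using False by simp
  next
    case True
    show ?thesis
    proof (cases "n = 0")
      case False
      with True have "n \<ge> 2" by (metis One_nat_def Suc_leI le_eq_less_or_eq neq0_conv odd_one one_add_one plus_1_eq_Suc)
      then have "(q / s) * (s gchoose n) * \<rho> ^ n * y ^ n \<le> (q gchoose n) * y ^ n"
        using True by (intro mult_right_mono gbinomial_even_le assms) (auto simp: zero_le_even_power)
      then show ?thesis using True False by (simp add: power_mult_distrib mult_ac)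
    qed simp
  qed
  ultimately have le: "(q / s) * H + (1 - q / s) \<le> G"
    by (metis (no_types, lifting) sums_le)
  have H0: "0 \<le> H" by (simp add: H_def)
  \<comment> \<open>Weighted AM-GM between \<open>H\<close> and 1 turns the linear bound
    \<open>le\<close> into one on \<open>H powr (q / s)\<close>.\<close>
  have "H powr (q / s) * 1 powr (1 - q / s) \<le> (q / s) * H + (1 - q / s) * 1"
  proof (cases "H = 0")
    case True then show ?thesis using q by simp
  next
    case False
    then show ?thesis using q H0 by (intro Youngs_inequality_0) auto
  qed
  with le have "H powr (q / s) \<le> G" by simp
  then have "(H powr (q / s)) powr (s / q) \<le> G powr (s / q)"
    using q by (intro powr_mono2) auto
  then show ?thesis using q H0 unfolding H_def[symmetric] G_def[symmetric]
    by (simp add: powr_powr)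
qed

text \<open>Both sides are homogeneous of degree \<open>s\<close> in \<open>u\<close> and
  \<open>v\<close>, so for positive arguments factoring out their mean leaves the normalized pair 1
  + y, 1 - y.\<close>

lemma two_point_hypercontractivity:
  fixes q s \<rho> u v :: real
  assumes q: "1 < q" "q \<le> s" "s \<le> 2" and \<rho>: "0 \<le> \<rho>" "\<rho> \<le> 1" "\<rho>\<^sup>2 * (s - 1) = q - 1"
    and uv: "0 \<le> u" "0 \<le> v"
  shows "(((1 + \<rho>) / 2 * u + (1 - \<rho>) / 2 * v) powr s + ((1 + \<rho>) / 2 * v + (1 - \<rho>) / 2 * u) powr s) / 2
    \<le> ((u powr q + v powr q) / 2) powr (s / q)"
proof -
  define L where "L u v = (((1 + \<rho>) / 2 * u + (1 - \<rho>) / 2 * v) powr s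
     + ((1 + \<rho>) / 2 * v + (1 - \<rho>) / 2 * u) powr s) / 2" for u v
  define U where "U u v = ((u powr q + v powr q) / 2) powr (s / q)" for u v
  have pos: "L u v \<le> U u v" if uv: "0 < u" "0 < v" for u v
  proof -
    define m where "m = (u + v) / 2"
    define y where "y = (u - v) / (u + v)"
    have m: "m > 0" using uv by (simp add: m_def)
    have y: "\<bar>y\<bar> < 1" using uv by (simp add: y_def abs_if field_simps)
    have \<rho>y: "\<bar>\<rho> * y\<bar> < 1"
      using \<rho> y by (simp add: abs_mult) (meson abs_ge_zero le_less_trans mult_left_le_one_le)
    have my: "m * y = (u - v) / 2" using uv by (simp add: m_def y_def field_simps)
    have u: "u = m * (1 + y)" and v: "v = m * (1 - y)"
      by (simp_all only: distrib_left right_diff_distrib my) (simp_all add: m_def field_simps)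
    have a: "(1 + \<rho>) / 2 * u + (1 - \<rho>) / 2 * v = m * (1 + \<rho> * y)"
      "(1 + \<rho>) / 2 * v + (1 - \<rho>) / 2 * u = m * (1 - \<rho> * y)"
      unfolding u v by (simp_all add: field_simps)
    have "L u v = m powr s * (((1 + \<rho> * y) powr s + (1 - \<rho> * y) powr s) / 2)"
      unfolding L_def a using m \<rho>y
      by (simp add: powr_mult abs_less_iff) (simp add: algebra_simps)
    also have "\<dots> \<le> m powr s * (((1 + y) powr q + (1 - y) powr q) / 2) powr (s / q)"
      by (intro mult_left_mono two_point_normalized assms y) auto
    also have "m powr s = (m powr q) powr (s / q)" using q by (simp add: powr_powr)
    also have "(m powr q) powr (s / q) * (((1 + y) powr q + (1 - y) powr q) / 2) powr (s / q)
        = (m powr q * (((1 + y) powr q + (1 - y) powr q) / 2)) powr (s / q)"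
      by (subst powr_mult) simp_all
    also have "\<dots> = U u v"
    proof -
      have "u powr q = m powr q * (1 + y) powr q" "v powr q = m powr q * (1 - y) powr q"
        using m y by (subst u v, simp add: powr_mult abs_less_iff)+
      then show ?thesis by (simp add: U_def algebra_simps)
    qed
    finally show ?thesis .
  qed
  \<comment> \<open>A vanishing \<open>u\<close> or \<open>v\<close> is not covered by
    \<open>pos\<close>. Both are shifted by a positive \<open>e\<close>, and the inequality survives
    the limit by continuity.\<close>
  have "((\<lambda>e. L (u + e) (v + e)) \<longlongrightarrow> L (u + 0) (v + 0)) (at_right 0)"
    unfolding L_def using q uv \<rho>
    by (intro tendsto_intros tendsto_powr')
       (auto simp: eventually_at_right_less intro!: eventually_mono[OF eventually_at_right_less] add_nonneg_nonneg)
  moreover have "((\<lambda>e. U (u + e) (v + e)) \<longlongrightarrow> U (u + 0) (v + 0)) (at_right 0)"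
    unfolding U_def using q uv
    by (intro tendsto_intros tendsto_powr')
       (auto simp: eventually_at_right_less intro!: eventually_mono[OF eventually_at_right_less] add_nonneg_nonneg)
  moreover have "eventually (\<lambda>e. L (u + e) (v + e) \<le> U (u + e) (v + e)) (at_right 0)"
    using uv by (intro eventually_mono[OF eventually_at_right_less] pos) auto
  ultimately have "L (u + 0) (v + 0) \<le> U (u + 0) (v + 0)"
    using tendsto_le trivial_limit_at_right_real by blast
  then show ?thesis by (simp add: L_def U_def)
qed

section \<open>Hoelder duality for the two-point inequality\<close>

lemma Holder_inequality_sum:
  fixes p s :: real
  assumes p: "p > 1" "s > 1" "1 / p + 1 / s = 1" and "finite I"
    and a: "\<And>i. i \<in> I \<Longrightarrow> 0 \<le> a i" and b: "\<And>i. i \<in> I \<Longrightarrow> 0 \<le> b i"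
  shows "(\<Sum>i\<in>I. a i * b i) \<le> (\<Sum>i\<in>I. a i powr p) powr (1 / p) * (\<Sum>i\<in>I. b i powr s) powr (1 / s)"
proof -
  define A where "A = (\<Sum>i\<in>I. a i powr p)"
  define B where "B = (\<Sum>i\<in>I. b i powr s)"
  have AB: "A \<ge> 0" "B \<ge> 0" by (auto simp: A_def B_def sum_nonneg)
  consider "A = 0" | "B = 0" | "A > 0" "B > 0" using AB by linarith
  then show ?thesis
  proof cases
    case 1
    then have "\<forall>i\<in>I. a i = 0" unfolding A_def using \<open>finite I\<close> by (subst (asm) sum_nonneg_eq_0_iff) auto
    then show ?thesis by simp
  next
    case 2
    then have "\<forall>i\<in>I. b i = 0" unfolding B_def using \<open>finite I\<close> by (subst (asm) sum_nonneg_eq_0_iff) auto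
    then show ?thesis by simp
  next
    case 3
    define \<alpha> where "\<alpha> = A powr (1 / p)"
    define \<beta> where "\<beta> = B powr (1 / s)"
    have pos: "\<alpha> > 0" "\<beta> > 0" using 3 by (auto simp: \<alpha>_def \<beta>_def)
    have pw: "\<alpha> powr p = A" "\<beta> powr s = B" using 3 p by (auto simp: \<alpha>_def \<beta>_def powr_powr)
    have "(\<Sum>i\<in>I. (a i / \<alpha>) * (b i / \<beta>)) \<le> (\<Sum>i\<in>I. (a i / \<alpha>) powr p / p + (b i / \<beta>) powr s / s)"
      using p a b pos by (intro sum_mono Youngs_inequality) auto
    also have "\<dots> = (\<Sum>i\<in>I. a i powr p) / A / p + (\<Sum>i\<in>I. b i powr s) / B / s"
      using a b pos pw by (simp add: powr_divide sum.distrib sum_divide_distrib)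
    also have "\<dots> = 1" using 3 p by (simp add: A_def[symmetric] B_def[symmetric])
    finally have "(\<Sum>i\<in>I. a i * b i) / (\<alpha> * \<beta>) \<le> 1" by (simp add: sum_divide_distrib)
    then show ?thesis using pos by (simp add: \<alpha>_def \<beta>_def A_def B_def)
  qed
qed

text \<open>Hoelder with exponents \<open>p\<close> and \<open>s\<close> reduces this to the
  two-point inequality. The bilinear form is the one that tensorizes: in the induction over the
  dimension it is applied to norms of restrictions.\<close>

lemma two_point_bilinear:
  fixes p q s \<rho> :: real
  assumes p: "p > 1" "1 / p + 1 / s = 1"
    and q: "1 < q" "q \<le> s" "s \<le> 2" and \<rho>: "0 \<le> \<rho>" "\<rho> \<le> 1" "\<rho>\<^sup>2 * (s - 1) = q - 1"
    and nn: "0 \<le> a" "0 \<le> b" "0 \<le> u" "0 \<le> v"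
  shows "(a * ((1 + \<rho>) / 2 * u + (1 - \<rho>) / 2 * v) + b * ((1 + \<rho>) / 2 * v + (1 - \<rho>) / 2 * u)) / 2
    \<le> ((a powr p + b powr p) / 2) powr (1 / p) * ((u powr q + v powr q) / 2) powr (1 / q)"
proof -
  define x where "x = (1 + \<rho>) / 2 * u + (1 - \<rho>) / 2 * v"
  define y where "y = (1 + \<rho>) / 2 * v + (1 - \<rho>) / 2 * u"
  have xy: "x \<ge> 0" "y \<ge> 0" using nn \<rho> by (auto simp: x_def y_def)
  have s: "s > 1" using q by simp
  have "(\<Sum>i\<in>{True,False}. (if i then a else b) * (if i then x else y))
     \<le> (\<Sum>i\<in>{True,False}. (if i then a else b) powr p) powr (1 / p)
       * (\<Sum>i\<in>{True,False}. (if i then x else y) powr s) powr (1 / s)"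
    using p s nn xy by (intro Holder_inequality_sum) auto
  then have "a * x + b * y \<le> (a powr p + b powr p) powr (1 / p) * (x powr s + y powr s) powr (1 / s)"
    by simp
  \<comment> \<open>Splitting the 2 this way turns both sums in the Hoelder bound into
    averages.\<close>
  moreover have "2 = 2 powr (1 / p) * 2 powr (1 / s :: real)"
    using p by (simp flip: powr_add)
  ultimately have "(a * x + b * y) / 2 \<le> (a powr p + b powr p) powr (1 / p) * (x powr s + y powr s) powr (1 / s)
      / (2 powr (1 / p) * 2 powr (1 / s))"
    by (metis divide_right_mono zero_le_numeral)
  also have "\<dots> = ((a powr p + b powr p) / 2) powr (1 / p) * ((x powr s + y powr s) / 2) powr (1 / s)"
    by (simp add: powr_divide)
  also have "\<dots> \<le> ((a powr p + b powr p) / 2) powr (1 / p) * (((u powr q + v powr q) / 2) powr (s / q)) powr (1 / s)"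
    unfolding x_def y_def using two_point_hypercontractivity[OF q \<rho> nn(3,4)] s
    by (intro mult_left_mono powr_mono2) auto
  also have "(((u powr q + v powr q) / 2) powr (s / q)) powr (1 / s) = ((u powr q + v powr q) / 2) powr (1 / q)"
    using s by (simp add: powr_powr)
  finally show ?thesis by (simp add: x_def y_def)
qed

section \<open>The noise operator on the cube\<close>

lemma expectation_bind_pmf_finite:
  fixes h :: "'b \<Rightarrow> real"
  assumes "finite (set_pmf p)" "\<And>x. x \<in> set_pmf p \<Longrightarrow> finite (set_pmf (f x))"
  shows "measure_pmf.expectation (bind_pmf p f) h =
    measure_pmf.expectation p (\<lambda>x. measure_pmf.expectation (f x) h)"
  using assms by (subst pmf_expectation_bind[of "set_pmf p"], auto)
    (subst integral_measure_pmf[of "set_pmf p"], auto)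

lemma expectation_pair_pmf_finite:
  fixes h :: "'a \<times> 'b \<Rightarrow> real"
  assumes "finite (set_pmf p)" "finite (set_pmf r)"
  shows "measure_pmf.expectation (pair_pmf p r) h =
    measure_pmf.expectation p (\<lambda>x. measure_pmf.expectation r (\<lambda>y. h (x, y)))"
  unfolding pair_pmf_def using assms
  by (subst expectation_bind_pmf_finite; (subst expectation_bind_pmf_finite)?; simp)

lemma expectation_mono_finite:
  fixes f g :: "'a \<Rightarrow> real"
  assumes "finite (set_pmf p)" "\<And>x. x \<in> set_pmf p \<Longrightarrow> f x \<le> g x"
  shows "measure_pmf.expectation p f \<le> measure_pmf.expectation p g"
  using assms by (intro integral_mono_AE integrable_measure_pmf_finite) (auto simp: AE_measure_pmf_iff)

lemma finite_set_Pi_pmf: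
  assumes "finite A" "\<And>x. x \<in> A \<Longrightarrow> finite (set_pmf (p x))"
  shows "finite (set_pmf (Pi_pmf A dflt p))"
  using assms by (auto simp: set_Pi_pmf intro!: finite_PiE_dflt)

lemma finite_set_rand_point [simp]: "finite (set_pmf (rand_point d))"
  unfolding rand_point_def by (intro finite_set_Pi_pmf) auto

lemma finite_set_noisy_copy [simp]: "finite (set_pmf (noisy_copy c d p))"
  unfolding noisy_copy_def by (intro finite_set_Pi_pmf) auto

text \<open>For \<open>c \<ge> 1\<close> this is the usual noise operator with correlation
  \<open>1 - 1 / c\<close>: a sign flipped with probability \<open>1 / (2 * c)\<close> has mean
  \<open>1 - 1 / c\<close> times its old value.\<close>

definition noise_op :: "real \<Rightarrow> nat \<Rightarrow> (point \<Rightarrow> real) \<Rightarrow> point \<Rightarrow> real" where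
  "noise_op c d g p = measure_pmf.expectation (noisy_copy c d p) g"

lemma noise_op_nonneg: "(\<And>q. 0 \<le> g q) \<Longrightarrow> 0 \<le> noise_op c d g p"
  unfolding noise_op_def by simp

lemma expectation_rand_point_Suc:
  "measure_pmf.expectation (rand_point (Suc d)) F =
    (measure_pmf.expectation (rand_point d) (\<lambda>p. F (p(d := 1)))
     + measure_pmf.expectation (rand_point d) (\<lambda>p. F (p(d := -1)))) / 2"
  for F :: "point \<Rightarrow> real"
  unfolding rand_point_def lessThan_Suc
  by (subst Pi_pmf_insert) 
     (auto simp: expectation_pair_pmf_finite finite_set_Pi_pmf integral_pmf_of_set)

lemma noise_op_Suc:
  assumes "c \<ge> 1"
  shows "noise_op c (Suc d) g (p(d := a)) =
    (1 - 1 / (2 * c)) * noise_op c d (\<lambda>q. g (q(d := a))) p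
     + 1 / (2 * c) * noise_op c d (\<lambda>q. g (q(d := - a))) p"
proof -
  have cong: "Pi_pmf {..<d} 0 (\<lambda>j. map_pmf (\<lambda>b. if b then - (p(d := a)) j else (p(d := a)) j) (bernoulli_pmf (1 / (2 * c))))
     = noisy_copy c d p"
    unfolding noisy_copy_def
  proof (intro Pi_pmf_cong refl)
    fix x assume "x \<in> {..<d}"
    then have "(p(d := a)) x = p x" by auto
    then show "map_pmf (\<lambda>b. if b then - (p(d := a)) x else (p(d := a)) x) (bernoulli_pmf (1 / (2 * c)))
      = map_pmf (\<lambda>b. if b then - p x else p x) (bernoulli_pmf (1 / (2 * c)))" by (simp only:)
  qed
  have "noisy_copy c (Suc d) (p(d := a)) = map_pmf (\<lambda>(b, f). f(d := b))
     (pair_pmf (map_pmf (\<lambda>b. if b then - a else a) (bernoulli_pmf (1 / (2 * c)))) (noisy_copy c d p))"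
    by (subst noisy_copy_def, subst lessThan_Suc, subst Pi_pmf_insert) (simp_all only: cong fun_upd_same, auto)
  then show ?thesis using assms
    by (simp add: noise_op_def expectation_pair_pmf_finite)
qed

text \<open>Conditioning on the last coordinate leaves four cross terms between restrictions of
  \<open>f\<close> and \<open>g\<close>, each bounded by induction by a product of norms. As
  functions of the last sign, these norms form a two-point instance of the same inequality.\<close>

lemma noise_op_bilinear:
  fixes p q s c :: real and f g :: "point \<Rightarrow> real"
  assumes c: "c \<ge> 1" and p: "p > 1" "1 / p + 1 / s = 1"
    and q: "1 < q" "q \<le> s" "s \<le> 2" "(1 - 1 / c)\<^sup>2 * (s - 1) = q - 1"
    and nn: "\<And>x. 0 \<le> f x" "\<And>x. 0 \<le> g x"
  shows "measure_pmf.expectation (rand_point d) (\<lambda>x. f x * noise_op c d g x)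
    \<le> measure_pmf.expectation (rand_point d) (\<lambda>x. f x powr p) powr (1 / p)
      * measure_pmf.expectation (rand_point d) (\<lambda>x. g x powr q) powr (1 / q)"
  using nn
proof (induction d arbitrary: f g)
  case 0
  then show ?case using p q by (simp add: rand_point_def noise_op_def noisy_copy_def powr_powr)
next
  case (Suc d)
  define \<rho> where "\<rho> = 1 - 1 / c"
  have \<rho>: "0 \<le> \<rho>" "\<rho> \<le> 1" "\<rho>\<^sup>2 * (s - 1) = q - 1" using c q by (auto simp: \<rho>_def)
  define E where "E F = measure_pmf.expectation (rand_point d) F" for F :: "point \<Rightarrow> real"
  define fa where "fa a x = f (x(d := a))" for a x
  define ga where "ga a x = g (x(d := a))" for a x
  define nf where "nf a = E (\<lambda>x. fa a x powr p) powr (1 / p)" for a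
  define ng where "ng a = E (\<lambda>x. ga a x powr q) powr (1 / q)" for a
  have E_nonneg: "0 \<le> E F" if "\<And>x. 0 \<le> F x" for F unfolding E_def using that by simp
  have IH: "E (\<lambda>x. fa a x * noise_op c d (ga b) x) \<le> nf a * ng b" for a b
    unfolding E_def nf_def ng_def using Suc.prems by (intro Suc.IH) (auto simp: fa_def ga_def)
  have w: "1 - 1 / (2 * c) = (1 + \<rho>) / 2" "1 / (2 * c) = (1 - \<rho>) / 2"
    using c by (auto simp: \<rho>_def field_simps)
  have half: "E (\<lambda>x. f (x(d := a)) * noise_op c (Suc d) g (x(d := a)))
    \<le> nf a * ((1 + \<rho>) / 2 * ng a + (1 - \<rho>) / 2 * ng (-a))" for a
  proof -
    have "E (\<lambda>x. f (x(d := a)) * noise_op c (Suc d) g (x(d := a)))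
      = E (\<lambda>x. (1 + \<rho>) / 2 * (fa a x * noise_op c d (ga a) x) + (1 - \<rho>) / 2 * (fa a x * noise_op c d (ga (-a)) x))"
      unfolding noise_op_Suc[OF c] w(1) unfolding w(2) fa_def ga_def by (simp only: distrib_left mult_ac)
    also have "\<dots> = (1 + \<rho>) / 2 * E (\<lambda>x. fa a x * noise_op c d (ga a) x)
        + (1 - \<rho>) / 2 * E (\<lambda>x. fa a x * noise_op c d (ga (-a)) x)"
      unfolding E_def
      by (subst Bochner_Integration.integral_add)
         (simp_all only: integrable_measure_pmf_finite finite_set_rand_point integral_mult_right_zero)
    also have "\<dots> \<le> (1 + \<rho>) / 2 * (nf a * ng a) + (1 - \<rho>) / 2 * (nf a * ng (-a))"
      using \<rho> by (intro add_mono mult_left_mono IH) auto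
    finally show ?thesis by (simp add: algebra_simps)
  qed
  \<comment> \<open>Undoing the roots lets the averages in the two-point bound reassemble into the
    norms of \<open>f\<close> and \<open>g\<close> in dimension \<open>Suc d\<close>.\<close>
  have powE: "nf a powr p = E (\<lambda>x. f (x(d := a)) powr p)" "ng a powr q = E (\<lambda>x. g (x(d := a)) powr q)" for a
    unfolding nf_def ng_def using p q E_nonneg by (simp_all add: powr_powr fa_def ga_def)
  have "measure_pmf.expectation (rand_point (Suc d)) (\<lambda>x. f x * noise_op c (Suc d) g x)
    \<le> (nf 1 * ((1 + \<rho>) / 2 * ng 1 + (1 - \<rho>) / 2 * ng (-1)) + nf (-1) * ((1 + \<rho>) / 2 * ng (-1) + (1 - \<rho>) / 2 * ng 1)) / 2"
    unfolding expectation_rand_point_Suc E_def[symmetric] using half[of 1] half[of "-1"] by simp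
  also have "\<dots> \<le> ((nf 1 powr p + nf (-1) powr p) / 2) powr (1 / p) * ((ng 1 powr q + ng (-1) powr q) / 2) powr (1 / q)"
    using p q \<rho> by (intro two_point_bilinear) (auto simp: nf_def ng_def)
  finally show ?case unfolding powE expectation_rand_point_Suc E_def[symmetric] .
qed

text \<open>The image \<open>T\<close> of the indicator is tested against
  \<open>T powr (s - 1)\<close>. For the exponent \<open>p\<close> conjugate to \<open>s\<close>,
  the p-norm of this test function is \<open>M powr (1 / p)\<close>, which cancels from the bilinear
  bound and leaves \<open>M powr (1 / s) \<le> b powr (1 / q)\<close>.\<close>

lemma noise_op_small_set:
  fixes q s c :: real
  assumes c: "c \<ge> 1" and q: "1 < q" "q \<le> s" "s \<le> 2" "(1 - 1 / c)\<^sup>2 * (s - 1) = q - 1"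
  shows "measure_pmf.expectation (rand_point d) (\<lambda>x. noise_op c d (indicator Q) x powr s)
    \<le> measure_pmf.prob (rand_point d) Q powr (s / q)"
proof -
  define T where "T = noise_op c d (indicator Q)"
  have T0: "0 \<le> T x" for x unfolding T_def by (intro noise_op_nonneg) auto
  define M where "M = measure_pmf.expectation (rand_point d) (\<lambda>x. T x powr s)"
  define b where "b = measure_pmf.prob (rand_point d) Q"
  define p where "p = s / (s - 1)"
  have p: "p > 1" "1 / p + 1 / s = 1" using q by (auto simp: p_def field_simps)
  have M0: "M \<ge> 0" unfolding M_def by simp
  have e1: "T x powr (s - 1) * noise_op c d (indicator Q) x = T x powr s" for x
    using T0[of x] unfolding T_def[symmetric] by (cases "T x = 0") (auto simp: powr_diff)
  have e2: "(T x powr (s - 1)) powr p = T x powr s" for x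
    using q by (simp add: powr_powr p_def)
  have e3: "indicator Q x powr q = (indicator Q x :: real)" for x by (auto simp: indicator_def)
  have "M \<le> M powr (1 / p) * b powr (1 / q)"
    using noise_op_bilinear[OF c p q, of "\<lambda>x. T x powr (s - 1)" "indicator Q" d]
    unfolding e1 e2 e3 by (simp add: M_def b_def)
  have "M \<le> b powr (s / q)"
  proof (cases "M = 0")
    case False
    then have "M > 0" using M0 by simp
    have "M powr (1 / p) * M powr (1 / s) = M" using \<open>M > 0\<close> p by (simp flip: powr_add)
    with \<open>M \<le> M powr (1 / p) * b powr (1 / q)\<close>
    have "M powr (1 / p) * M powr (1 / s) \<le> M powr (1 / p) * b powr (1 / q)" by simp
    then have "M powr (1 / s) \<le> b powr (1 / q)" using \<open>M > 0\<close> by simp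
    then have "(M powr (1 / s)) powr s \<le> (b powr (1 / q)) powr s" using q by (intro powr_mono2) auto
    then show ?thesis using q M0 by (simp add: powr_powr)
  qed simp
  then show ?thesis by (simp add: M_def b_def T_def)
qed

section \<open>Point masses of the noise and recovery of the planted point\<close>

lemma set_rand_point: "set_pmf (rand_point d) = PiE_dflt {..<d} 0 (\<lambda>_. {-1, 1})"
  unfolding rand_point_def by (simp add: set_Pi_pmf comp_def)

lemma pmf_rand_point:
  assumes "p \<in> set_pmf (rand_point d)" shows "pmf (rand_point d) p = (1 / 2) ^ d"
proof -
  have p: "\<And>x. x < d \<Longrightarrow> p x \<in> {-1, 1}" "\<And>x. x \<notin> {..<d} \<Longrightarrow> p x = 0"
    using assms by (auto simp: set_rand_point PiE_dflt_def)
  have "pmf (rand_point d) p = (\<Prod>x<d. pmf (pmf_of_set {-1, 1}) (p x))"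
    unfolding rand_point_def by (rule pmf_Pi') (use p(2) in auto)
  also have "\<dots> = (\<Prod>x<d. 1 / 2)"
  proof (intro prod.cong refl)
    fix x assume "x \<in> {..<d}"
    then have "p x \<in> {-1, 1}" using p(1) by simp
    then show "pmf (pmf_of_set {-1, 1}) (p x) = 1 / 2" by (subst pmf_of_set) auto
  qed
  finally show ?thesis by (simp add: power_divide)
qed

lemma set_noisy_copy_subset:
  assumes "p \<in> set_pmf (rand_point d)"
  shows "set_pmf (noisy_copy c d p) \<subseteq> set_pmf (rand_point d)"
proof
  fix q assume q: "q \<in> set_pmf (noisy_copy c d p)"
  have "(x < d \<longrightarrow> q x \<in> {-1, 1}) \<and> (\<not> x < d \<longrightarrow> q x = 0)" for x
  proof (cases "x < d")
    case True
    have "q x \<in> set_pmf (map_pmf (\<lambda>b. if b then - p x else p x) (bernoulli_pmf (1 / (2 * c))))"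
      using subsetD[OF set_Pi_pmf_subset'[OF finite_lessThan] q[unfolded noisy_copy_def]] True
      by (simp add: PiE_dflt_def)
    then have "q x = p x \<or> q x = - p x" unfolding set_map_pmf by fastforce
    moreover have "p x = -1 \<or> p x = 1" using assms True by (simp add: set_rand_point PiE_dflt_def)
    ultimately show ?thesis using True by auto
  next
    case False
    then show ?thesis
      using subsetD[OF set_Pi_pmf_subset'[OF finite_lessThan] q[unfolded noisy_copy_def]]
      by (simp add: PiE_dflt_def)
  qed
  then show "q \<in> set_pmf (rand_point d)"
    unfolding set_rand_point PiE_dflt_def by simp
qed

text \<open>For \<open>c \<ge> 1\<close> keeping a sign is at least as likely as flipping it, so no
  coordinate has an outcome of mass above \<open>1 - 1 / (2 * c)\<close>.\<close>

lemma pmf_noisy_copy_le: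
  assumes c: "c \<ge> 1" and p: "p \<in> set_pmf (rand_point d)"
  shows "pmf (noisy_copy c d p) q \<le> (1 - 1 / (2 * c)) ^ d"
proof -
  have bit: "pmf (map_pmf (\<lambda>b. if b then - a else a) (bernoulli_pmf (1 / (2 * c)))) z \<le> 1 - 1 / (2 * c)"
    if "a \<in> {-1, 1}" for a z :: int
  proof -
    \<comment> \<open>Since \<open>a\<close> is nonzero, \<open>a\<close> and \<open>- a\<close>
      differ, so the outcome determines the flip.\<close>
    have "(\<lambda>b. if b then - a else a) -` {z} \<subseteq> {z \<noteq> a}" using that by (auto split: if_splits)
    then have "pmf (map_pmf (\<lambda>b. if b then - a else a) (bernoulli_pmf (1 / (2 * c)))) z
      \<le> measure_pmf.prob (bernoulli_pmf (1 / (2 * c))) {z \<noteq> a}"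
      by (simp add: pmf_map measure_pmf.finite_measure_mono)
    also have "\<dots> = pmf (bernoulli_pmf (1 / (2 * c))) (z \<noteq> a)" by (rule measure_pmf_single)
    also have "\<dots> \<le> 1 - 1 / (2 * c)"
    proof -
      have "1 / (2 * c) \<le> 1 / 2" "0 \<le> 1 / (2 * c)" using c by (auto simp: field_simps)
      then show ?thesis by (cases "z = a") simp_all
    qed
    finally show ?thesis .
  qed
  have "pmf (noisy_copy c d p) q \<le> (\<Prod>j<d. pmf (map_pmf (\<lambda>b. if b then - p j else p j) (bernoulli_pmf (1 / (2 * c)))) (q j))"
    unfolding noisy_copy_def by (subst pmf_Pi) (auto intro!: prod_nonneg)
  also have "\<dots> \<le> (\<Prod>j<d. 1 - 1 / (2 * c))"
    using p by (intro prod_mono conjI bit) (auto simp: set_rand_point PiE_dflt_def)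
  finally show ?thesis by simp
qed

text \<open>Each query has a single answer, and the point mass of the noise at that answer is small.\<close>
lemma expected_recovery_le:
  fixes A :: "point \<Rightarrow> point"
  assumes c: "c \<ge> 1"
  shows "measure_pmf.expectation (rand_point d) (\<lambda>p. measure_pmf.prob (noisy_copy c d p) {q \<in> Q. A q = p})
    \<le> (1 - 1 / (2 * c)) ^ d * measure_pmf.prob (rand_point d) Q"
proof -
  define C where "C = set_pmf (rand_point d)"
  have fC: "finite C" by (simp add: C_def)
  have "measure_pmf.expectation (rand_point d) (\<lambda>p. measure_pmf.prob (noisy_copy c d p) {q \<in> Q. A q = p})
    = (\<Sum>p\<in>C. (1 / 2) ^ d * (\<Sum>q\<in>C. if q \<in> Q \<and> A q = p then pmf (noisy_copy c d p) q else 0))"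
  proof (subst integral_measure_pmf[of C], simp add: fC, simp add: C_def, intro sum.cong refl)
    fix p assume p: "p \<in> C"
    have "measure_pmf.prob (noisy_copy c d p) {q \<in> Q. A q = p}
      = measure_pmf.expectation (noisy_copy c d p) (indicator {q \<in> Q. A q = p})" by simp
    also have "\<dots> = (\<Sum>q\<in>C. pmf (noisy_copy c d p) q *\<^sub>R indicator {q \<in> Q. A q = p} q)"
      using set_noisy_copy_subset[of p d c] p by (intro integral_measure_pmf fC) (auto simp: C_def)
    also have "\<dots> = (\<Sum>q\<in>C. if q \<in> Q \<and> A q = p then pmf (noisy_copy c d p) q else 0)"
      by (intro sum.cong) auto
    finally show "pmf (rand_point d) p *\<^sub>R measure_pmf.prob (noisy_copy c d p) {q \<in> Q. A q = p}
      = (1 / 2) ^ d * (\<Sum>q\<in>C. if q \<in> Q \<and> A q = p then pmf (noisy_copy c d p) q else 0)"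
      using p pmf_rand_point[of p d] by (simp add: C_def)
  qed
  \<comment> \<open>After swapping the sums, a fixed query leaves at most one nonzero term, namely
    \<open>p = A q\<close>.\<close>
  also have "\<dots> = (\<Sum>q\<in>C. (1 / 2) ^ d * (\<Sum>p\<in>C. if A q = p then (if q \<in> Q then pmf (noisy_copy c d p) q else 0) else 0))"
    unfolding sum_distrib_left by (subst sum.swap) (intro sum.cong refl, auto)
  also have "\<dots> \<le> (\<Sum>q\<in>C. (1 / 2) ^ d * (if q \<in> Q then (1 - 1 / (2 * c)) ^ d else 0))"
    using c by (intro sum_mono mult_left_mono)
      (auto simp: sum.delta' fC C_def intro!: pmf_noisy_copy_le zero_le_power)
  also have "\<dots> = (1 - 1 / (2 * c)) ^ d * (\<Sum>q\<in>C. pmf (rand_point d) q *\<^sub>R (indicator Q q :: real))"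
    unfolding sum_distrib_left by (intro sum.cong) (auto simp: pmf_rand_point C_def)
  also have "(\<Sum>q\<in>C. pmf (rand_point d) q *\<^sub>R (indicator Q q :: real)) = measure_pmf.expectation (rand_point d) (indicator Q)"
    by (intro integral_measure_pmf[symmetric] fC) (auto simp: C_def)
  finally show ?thesis by simp
qed

section \<open>Adaptively chosen cell contents\<close>

lemma expectation_Pi_pmf_component_sum:
  fixes f :: "'a \<Rightarrow> real"
  assumes "finite (set_pmf \<mu>)"
  shows "measure_pmf.expectation (Pi_pmf {..<n} z (\<lambda>_. \<mu>)) (\<lambda>P. \<Sum>i<n. f (P i))
    = real n * measure_pmf.expectation \<mu> f"
proof -
  have "measure_pmf.expectation (Pi_pmf {..<n} z (\<lambda>_. \<mu>)) (\<lambda>P. \<Sum>i<n. f (P i))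
    = (\<Sum>i<n. measure_pmf.expectation (Pi_pmf {..<n} z (\<lambda>_. \<mu>)) (\<lambda>P. f (P i)))"
    using assms by (intro Bochner_Integration.integral_sum integrable_measure_pmf_finite finite_set_Pi_pmf) auto
  also have "\<dots> = (\<Sum>i<n. measure_pmf.expectation (map_pmf (\<lambda>P. P i) (Pi_pmf {..<n} z (\<lambda>_. \<mu>))) f)"
    by simp
  also have "\<dots> = (\<Sum>i<n. measure_pmf.expectation \<mu> f)"
    by (intro sum.cong refl, subst Pi_pmf_component) auto
  finally show ?thesis by simp
qed

text \<open>An index chosen adaptively among K alternatives costs only an additive ln K: the
  exponential moment of the sum at the chosen index is at most the total over all indices.\<close>
lemma expectation_adaptive_sum_le:
  fixes u :: "nat \<Rightarrow> 'a \<Rightarrow> real" and T :: "(nat \<Rightarrow> 'a) \<Rightarrow> nat"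
  assumes fin: "finite (set_pmf \<mu>)" and T: "\<And>P. T P < K"
    and u: "\<And>k x. 0 \<le> u k x" "\<And>k x. u k x \<le> 1"
    and m: "\<And>k. k < K \<Longrightarrow> measure_pmf.expectation \<mu> (u k) \<le> m"
  shows "measure_pmf.expectation (Pi_pmf {..<n} z (\<lambda>_. \<mu>)) (\<lambda>P. \<Sum>i<n. u (T P) (P i))
    \<le> ln (real K) + 2 * real n * m"
proof -
  define D where "D = Pi_pmf {..<n} z (\<lambda>_. \<mu>)"
  have finD: "finite (set_pmf D)" unfolding D_def using fin by (intro finite_set_Pi_pmf) auto
  have int: "integrable D F" for F :: "(nat \<Rightarrow> 'a) \<Rightarrow> real" by (rule integrable_measure_pmf_finite[OF finD])
  \<comment> \<open>\<open>L\<close> solves \<open>K * exp (2 * n * m) * exp (- L) = 1\<close>. With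
    \<open>Y \<le> exp (Y - L) + L - 1\<close> and the moment bound, the exponential part then
    contributes at most 1 and the total is \<open>L\<close>.\<close>
  define L where "L = ln (real K) + 2 * real n * m"
  define Y where "Y k P = (\<Sum>i<n. u k (P i))" for k P
  have K: "K > 0" using T[of undefined] by simp
  have moment: "measure_pmf.expectation D (\<lambda>P. exp (Y k P)) \<le> exp (2 * real n * m)" if "k < K" for k
  proof -
    have "measure_pmf.expectation D (\<lambda>P. exp (Y k P)) = measure_pmf.expectation D (\<lambda>P. \<Prod>i\<in>{..<n}. exp (u k (P i)))"
      by (simp add: Y_def exp_sum)
    also have "\<dots> = (\<Prod>i\<in>{..<n}. measure_pmf.expectation \<mu> (\<lambda>x. exp (u k x)))"
      unfolding D_def using fin by (intro expectation_prod_Pi_pmf integrable_measure_pmf_finite) auto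
    also have "\<dots> \<le> (\<Prod>i\<in>{..<n}. exp (2 * m))"
    proof (intro prod_mono conjI)
      have "measure_pmf.expectation \<mu> (\<lambda>x. exp (u k x)) \<le> measure_pmf.expectation \<mu> (\<lambda>x. 1 + 2 * u k x)"
      proof (intro expectation_mono_finite fin)
        fix x
        \<comment> \<open>On the unit interval
          \<open>exp u \<le> 1 + u + u^2 \<le> 1 + 2 * u\<close>; this is the origin of the factor 2
          in front of \<open>n * m\<close>.\<close>
        have "(u k x)\<^sup>2 \<le> u k x" using u[of k x] by (simp add: power2_eq_square mult_left_le)
        then show "exp (u k x) \<le> 1 + 2 * u k x" using exp_bound[OF u(1) u(2), of k x] by linarith
      qed
      also have "\<dots> = 1 + 2 * measure_pmf.expectation \<mu> (u k)"
        by (subst Bochner_Integration.integral_add) (auto intro: integrable_measure_pmf_finite fin)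
      also have "\<dots> \<le> 1 + 2 * m" using m[OF that] by simp
      also have "\<dots> \<le> exp (2 * m)" by (rule exp_ge_add_one_self)
      finally show "measure_pmf.expectation \<mu> (\<lambda>x. exp (u k x)) \<le> exp (2 * m)" .
    qed simp
    also have "\<dots> = exp (2 * real n * m)" by (simp flip: exp_of_nat_mult) 
    finally show ?thesis .
  qed
  have "measure_pmf.expectation D (\<lambda>P. Y (T P) P)
    \<le> measure_pmf.expectation D (\<lambda>P. (\<Sum>k<K. exp (Y k P) * exp (- L)) + (L - 1))"
  proof (intro expectation_mono_finite finD)
    fix P
    have "1 + (Y (T P) P - L) \<le> exp (Y (T P) P - L)" by (rule exp_ge_add_one_self)
    also have "\<dots> = exp (Y (T P) P) * exp (- L)" by (simp flip: exp_add)
    also have "\<dots> \<le> (\<Sum>k<K. exp (Y k P) * exp (- L))"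
      using T[of P] by (intro member_le_sum) auto
    finally show "Y (T P) P \<le> (\<Sum>k<K. exp (Y k P) * exp (- L)) + (L - 1)" by simp
  qed
  also have "\<dots> = (\<Sum>k<K. measure_pmf.expectation D (\<lambda>P. exp (Y k P)) * exp (- L)) + (L - 1)"
    by (subst Bochner_Integration.integral_add) (auto simp: int Bochner_Integration.integral_sum)
  also have "\<dots> \<le> (\<Sum>k<K. exp (2 * real n * m) * exp (- L)) + (L - 1)"
    by (intro add_right_mono sum_mono mult_right_mono moment) auto
  also have "\<dots> = L"
  proof -
    have "exp (- L) = 1 / (real K * exp (2 * real n * m))"
      using K by (simp add: L_def exp_minus exp_add inverse_eq_divide del: minus_add_distrib)
    then show ?thesis using K by simp
  qed
  finally show ?thesis by (simp add: Y_def L_def D_def)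
qed

text \<open>The part of \<open>h\<close> below \<theta>, scaled to the unit interval, pays for the
  adaptive choice of content, at cost \<theta> times \<open>ln (2 ^ w)\<close>. The part above is
  dominated by a function of \<open>g\<close> alone, which does not depend on the content, so its
  plain expectation suffices.\<close>

lemma expected_cell_load_le:
  fixes h :: "nat \<Rightarrow> 'a \<Rightarrow> real" and g :: "'a \<Rightarrow> real" and T :: "(nat \<Rightarrow> 'a) \<Rightarrow> nat"
  assumes fin: "finite (set_pmf \<mu>)" and T: "\<And>P. T P < 2 ^ w"
    and h: "\<And>k x. 0 \<le> h k x" "\<And>k x. h k x \<le> g x"
    and m: "\<And>k. measure_pmf.expectation \<mu> (h k) \<le> m" and \<theta>: "\<theta> > 0"
    and s: "s \<ge> 1" and M: "measure_pmf.expectation \<mu> (\<lambda>x. g x powr s) \<le> M"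
  shows "measure_pmf.expectation (Pi_pmf {..<n} z (\<lambda>_. \<mu>)) (\<lambda>P. \<Sum>i<n. h (T P) (P i))
    \<le> \<theta> * real w + 2 * real n * m + real n * (\<theta> powr (1 - s) * M)"
proof -
  define D where "D = Pi_pmf {..<n} z (\<lambda>_. \<mu>)"
  have finD: "finite (set_pmf D)" unfolding D_def using fin by (intro finite_set_Pi_pmf) auto
  have int: "integrable D F" for F :: "(nat \<Rightarrow> 'a) \<Rightarrow> real" by (rule integrable_measure_pmf_finite[OF finD])
  define u where "u k x = min (h k x) \<theta> / \<theta>" for k x
  define v where "v x = \<theta> powr (1 - s) * g x powr s" for x
  have g0: "0 \<le> g x" for x using h[of 0 x] by linarith
  have split: "h k x \<le> \<theta> * u k x + v x" for k x
  proof (cases "h k x \<le> \<theta>")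
    case True
    then show ?thesis using \<theta> by (simp add: u_def v_def)
  next
    case False
    then have g: "\<theta> < g x" using h(2)[of k x] by linarith
    \<comment> \<open>Here \<open>g x\<close> exceeds \<theta> and \<open>1 - s\<close> is not
      positive, so \<open>g x powr (1 - s)\<close> is at most
      \<open>\<theta> powr (1 - s)\<close>.\<close>
    have "h k x \<le> g x powr (1 - s) * g x powr s" using h(2)[of k x] g \<theta> by (simp flip: powr_add)
    also have "\<dots> \<le> v x" unfolding v_def using g \<theta> s
      by (intro mult_right_mono powr_mono2') auto
    finally show ?thesis using \<theta> h by (simp add: u_def add_increasing)
  qed
  have u: "0 \<le> u k x" "u k x \<le> 1" for k x using \<theta> h(1)[of k x] by (auto simp: u_def)
  have um: "measure_pmf.expectation \<mu> (u k) \<le> m / \<theta>" for k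
  proof -
    have "measure_pmf.expectation \<mu> (u k) \<le> measure_pmf.expectation \<mu> (\<lambda>x. h k x / \<theta>)"
      using \<theta> by (intro expectation_mono_finite fin) (auto simp: u_def divide_right_mono)
    also have "\<dots> \<le> m / \<theta>" using m[of k] \<theta> by (simp add: divide_right_mono)
    finally show ?thesis .
  qed
  have "measure_pmf.expectation D (\<lambda>P. \<Sum>i<n. h (T P) (P i))
    \<le> measure_pmf.expectation D (\<lambda>P. \<theta> * (\<Sum>i<n. u (T P) (P i)) + (\<Sum>i<n. v (P i)))"
    by (intro expectation_mono_finite finD)
       (auto simp: sum_distrib_left simp flip: sum.distrib intro!: sum_mono split)
  also have "\<dots> = \<theta> * measure_pmf.expectation D (\<lambda>P. \<Sum>i<n. u (T P) (P i))
      + measure_pmf.expectation D (\<lambda>P. \<Sum>i<n. v (P i))"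
    by (subst Bochner_Integration.integral_add) (auto simp: int)
  also have "\<dots> \<le> \<theta> * (ln (real (2 ^ w)) + 2 * real n * (m / \<theta>)) + real n * measure_pmf.expectation \<mu> v"
    unfolding D_def using \<theta> 
    by (intro add_mono mult_left_mono expectation_adaptive_sum_le fin T u um)
       (auto simp: expectation_Pi_pmf_component_sum fin)
  also have "\<dots> = \<theta> * ln (real (2 ^ w)) + 2 * real n * m + real n * measure_pmf.expectation \<mu> v"
    using \<theta> by (simp add: field_simps)
  also have "\<dots> \<le> \<theta> * real w + 2 * real n * m + real n * (\<theta> powr (1 - s) * M)"
  proof -
    have "ln (real (2 ^ w)) \<le> real w * 1"
      using ln_2_less_1 by (simp add: ln_realpow mult_left_le)
    moreover have "measure_pmf.expectation \<mu> v \<le> \<theta> powr (1 - s) * M"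
      unfolding v_def using M by (simp add: mult_left_mono)
    ultimately show ?thesis using \<theta> by (intro add_mono mult_left_mono) auto
  qed
  finally show ?thesis unfolding D_def .
qed

section \<open>The space bound\<close>

lemma prob_hamming_instance:
  assumes "n \<ge> 1"
  shows "measure_pmf.prob (hamming_instance n c d) A
    = measure_pmf.expectation (Pi_pmf {..<n} (\<lambda>_. 0) (\<lambda>_. rand_point d))
        (\<lambda>P. (\<Sum>i<n. measure_pmf.prob (noisy_copy c d (P i)) {q. (P, i, q) \<in> A}) / real n)"
proof -
  have fin: "finite (set_pmf (Pi_pmf {..<n} (\<lambda>_. 0) (\<lambda>_. rand_point d)))"
    by (intro finite_set_Pi_pmf) auto
  have ne: "{..<n} \<noteq> {}" using assms by (auto simp: lessThan_empty_iff)
  have ind: "(\<lambda>q. indicator A (P, i, q) :: real) = indicator {q. (P, i, q) \<in> A}" for P i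
    by (auto simp: indicator_def)
  have bind: "measure_pmf.expectation (hamming_instance n c d) F
    = measure_pmf.expectation (Pi_pmf {..<n} (\<lambda>_. 0) (\<lambda>_. rand_point d))
     (\<lambda>P. measure_pmf.expectation (pmf_of_set {..<n}) (\<lambda>i. measure_pmf.expectation (noisy_copy c d (P i))
        (\<lambda>q. F (P, i, q))))" for F :: "_ \<Rightarrow> real"
    unfolding hamming_instance_def using ne fin
    by (simp add: expectation_bind_pmf_finite)
  have "measure_pmf.prob (hamming_instance n c d) A
    = measure_pmf.expectation (hamming_instance n c d) (indicator A :: _ \<Rightarrow> real)" by simp
  also note bind
  finally show ?thesis
    unfolding ind using ne by (simp add: integral_pmf_of_set)
qed

text \<open>Each shifted term is at least \<open>1 / S\<close>, so its power \<open>t - 1\<close> is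
  at most \<open>S powr (1 - t)\<close>, and the shifted terms sum to at most 2. The shift also
  keeps cells of measure zero away from 0.\<close>

lemma sum_powr_shift_le:
  fixes b :: "nat \<Rightarrow> real"
  assumes S: "S \<ge> 1" and b: "\<And>j. j < S \<Longrightarrow> 0 \<le> b j" "(\<Sum>j<S. b j) \<le> 1" and t: "t \<le> 1"
  shows "(\<Sum>j<S. (b j + 1 / real S) powr t) \<le> 2 * real S powr (1 - t)"
proof -
  have "(\<Sum>j<S. (b j + 1 / real S) powr t) \<le> (\<Sum>j<S. (b j + 1 / real S) * real S powr (1 - t))"
  proof (intro sum_mono)
    fix j assume "j \<in> {..<S}"
    then have ge: "1 / real S \<le> b j + 1 / real S" and S0: "0 < 1 / real S" using b S by auto
    have "(b j + 1 / real S) powr t = (b j + 1 / real S) * (b j + 1 / real S) powr (t - 1)"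
      using ge S0 by (simp add: powr_diff)
    also have "\<dots> \<le> (b j + 1 / real S) * (1 / real S) powr (t - 1)"
      using ge S0 t by (intro mult_left_mono powr_mono2') auto
    also have "(1 / real S) powr (t - 1) = real S powr (1 - t)"
      using S by (simp add: powr_divide powr_minus_divide[symmetric])
    finally show "(b j + 1 / real S) powr t \<le> (b j + 1 / real S) * real S powr (1 - t)" .
  qed
  also have "\<dots> = ((\<Sum>j<S. b j) + 1) * real S powr (1 - t)"
    using S by (simp add: sum.distrib flip: sum_distrib_right)
  also have "\<dots> \<le> 2 * real S powr (1 - t)" using b by (intro mult_right_mono) auto
  finally show ?thesis .
qed

lemma deterministic_success_le:
  fixes tbl :: "dataset \<Rightarrow> nat \<Rightarrow> nat" and prb :: "point \<Rightarrow> nat" and ans :: "point \<Rightarrow> nat \<Rightarrow> point"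
  assumes n: "n \<ge> 1" and c: "c \<ge> 1"
    and q: "1 < q" "q \<le> s" "s \<le> 2" "(1 - 1 / c)\<^sup>2 * (s - 1) = q - 1"
    and prb: "\<And>x. prb x < S" and tbl: "\<And>P j. tbl P j < 2 ^ w"
  shows "measure_pmf.prob (hamming_instance n c d) {(P, i, x). ans x (tbl P (prb x)) = P i}
    \<le> 2 * (1 - 1 / (2 * c)) ^ d + 4 * ((real w + 1) / real n) powr (1 - 1 / s) * real S powr (1 - 1 / q)"
proof -
  define \<mu> where "\<mu> = rand_point d"
  define \<epsilon> where "\<epsilon> = (1 - 1 / (2 * c)) ^ d"
  define D where "D = Pi_pmf {..<n} (\<lambda>_. 0) (\<lambda>_. \<mu>)"
  have finD: "finite (set_pmf D)" unfolding D_def \<mu>_def by (intro finite_set_Pi_pmf) auto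
  define Q where "Q j = {x. prb x = j}" for j
  define h where "h j k p = measure_pmf.prob (noisy_copy c d p) {x \<in> Q j. ans x k = p}" for j k p
  define g where "g j = noise_op c d (indicator (Q j))" for j
  define b where "b j = measure_pmf.prob \<mu> (Q j)" for j
  \<comment> \<open>Using \<open>w + 1\<close> keeps \<alpha> positive even for empty words.\<close>
  define \<alpha> where "\<alpha> = (real w + 1) / real n"
  \<comment> \<open>This threshold balances the two costs of a cell: both
    \<open>\<alpha> * \<theta> j\<close> and the tail term become
    \<open>\<alpha> powr (1 - 1 / s) * (b j + 1 / S) powr (1 / q)\<close>.\<close>
  define \<theta> where "\<theta> j = \<alpha> powr (- 1 / s) * (b j + 1 / real S) powr (1 / q)" for j
  have S: "S \<ge> 1" using prb[of undefined] by simp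
  have \<epsilon>0: "\<epsilon> \<ge> 0" using c by (simp add: \<epsilon>_def)
  have \<alpha>: "\<alpha> > 0" using n by (simp add: \<alpha>_def)
  have b0: "0 \<le> b j" for j by (simp add: b_def)
  have \<beta>: "b j + 1 / real S > 0" for j using b0[of j] S by (simp add: add_nonneg_pos)
  have b1: "(\<Sum>j<S. b j) \<le> 1"
  proof -
    have "(\<Sum>j<S. b j) = measure_pmf.prob \<mu> (\<Union>j<S. Q j)"
      unfolding b_def by (intro measure_pmf.finite_measure_finite_Union[symmetric])
        (auto simp: disjoint_family_on_def Q_def)
    then show ?thesis by simp
  qed
  have cell: "measure_pmf.expectation D (\<lambda>P. \<Sum>i<n. h j (tbl P j) (P i))
     \<le> real n * (2 * \<alpha> powr (1 - 1 / s) * (b j + 1 / real S) powr (1 / q) + 2 * (\<epsilon> * b j))" if "j < S" for j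
  proof -
    have "measure_pmf.expectation D (\<lambda>P. \<Sum>i<n. h j (tbl P j) (P i))
      \<le> \<theta> j * real w + 2 * real n * (\<epsilon> * b j) + real n * (\<theta> j powr (1 - s) * b j powr (s / q))"
      unfolding D_def
    proof (rule expected_cell_load_le[where g = "g j"])
      show "h j k x \<le> g j x" for k x
        unfolding h_def g_def noise_op_def by (simp add: measure_pmf.finite_measure_mono)
      show "measure_pmf.expectation \<mu> (h j k) \<le> \<epsilon> * b j" for k
        unfolding h_def \<mu>_def \<epsilon>_def b_def by (rule expected_recovery_le[OF c])
      show "measure_pmf.expectation \<mu> (\<lambda>x. g j x powr s) \<le> b j powr (s / q)"
        unfolding g_def \<mu>_def b_def by (rule noise_op_small_set[OF c q])
    qed (use q tbl \<alpha> \<beta>[of j] in \<open>auto simp: h_def \<mu>_def \<theta>_def\<close>)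
    also have "\<dots> \<le> real n * (\<alpha> * \<theta> j) + 2 * real n * (\<epsilon> * b j)
        + real n * (\<theta> j powr (1 - s) * (b j + 1 / real S) powr (s / q))"
    proof -
      have "\<theta> j * real w \<le> \<theta> j * (real w + 1)" unfolding \<theta>_def by (intro mult_left_mono) auto
      also have "\<dots> = real n * (\<alpha> * \<theta> j)" using n by (simp add: \<alpha>_def)
      finally show ?thesis using q b0[of j] S by (intro add_mono mult_left_mono powr_mono2) (auto simp: \<epsilon>0)
    qed
    also have "\<theta> j powr (1 - s) * (b j + 1 / real S) powr (s / q) = \<alpha> powr (1 - 1 / s) * (b j + 1 / real S) powr (1 / q)"
    proof -
      have e: "- 1 / s * (1 - s) = 1 - 1 / s" "1 / q * (1 - s) + s / q = 1 / q" using q by (auto simp: field_simps)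
      have "\<theta> j powr (1 - s) * (b j + 1 / real S) powr (s / q)
        = \<alpha> powr (- 1 / s * (1 - s)) * (b j + 1 / real S) powr (1 / q * (1 - s) + s / q)"
        unfolding \<theta>_def using \<alpha> \<beta>[of j] by (simp add: powr_mult powr_powr powr_add)
      then show ?thesis unfolding e .
    qed
    also have "\<alpha> * \<theta> j = \<alpha> powr (1 - 1 / s) * (b j + 1 / real S) powr (1 / q)"
    proof -
      have "\<alpha> * \<alpha> powr (- 1 / s) = \<alpha> powr (1 - 1 / s)"
        using \<alpha> powr_add[of \<alpha> 1 "- 1 / s"] by simp
      then show ?thesis by (simp add: \<theta>_def mult.assoc[symmetric])
    qed
    finally show ?thesis by (simp add: algebra_simps)
  qed
  \<comment> \<open>The sets \<open>Q j\<close> partition the queries, so success splits over cells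
    and each summand involves the content of a single cell.\<close>
  have pt: "measure_pmf.prob (noisy_copy c d (P i)) {x. ans x (tbl P (prb x)) = P i}
      = (\<Sum>j<S. h j (tbl P j) (P i))" for P i
  proof -
    have "{x. ans x (tbl P (prb x)) = P i} = (\<Union>j<S. {x \<in> Q j. ans x (tbl P j) = P i})"
      using prb by (auto simp: Q_def)
    then show ?thesis unfolding h_def
      by (simp, intro measure_pmf.finite_measure_finite_Union) (auto simp: disjoint_family_on_def Q_def)
  qed
  have "measure_pmf.prob (hamming_instance n c d) {(P, i, x). ans x (tbl P (prb x)) = P i}
    = measure_pmf.expectation D (\<lambda>P. (\<Sum>j<S. \<Sum>i<n. h j (tbl P j) (P i))) / real n"
    unfolding prob_hamming_instance[OF n] D_def \<mu>_def by (simp add: pt sum.swap[of _ "{..<n}"])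
  moreover have "measure_pmf.expectation D (\<lambda>P. (\<Sum>j<S. \<Sum>i<n. h j (tbl P j) (P i)))
    \<le> (2 * \<epsilon> + 4 * \<alpha> powr (1 - 1 / s) * real S powr (1 - 1 / q)) * real n"
  proof -
    have "measure_pmf.expectation D (\<lambda>P. (\<Sum>j<S. \<Sum>i<n. h j (tbl P j) (P i)))
      = (\<Sum>j<S. measure_pmf.expectation D (\<lambda>P. \<Sum>i<n. h j (tbl P j) (P i)))"
      by (intro Bochner_Integration.integral_sum integrable_measure_pmf_finite finD)
    also have "\<dots> \<le> (\<Sum>j<S. real n * (2 * \<alpha> powr (1 - 1 / s) * (b j + 1 / real S) powr (1 / q) + 2 * (\<epsilon> * b j)))"
      by (intro sum_mono cell) auto
    also have "\<dots> = real n * (2 * \<alpha> powr (1 - 1 / s) * (\<Sum>j<S. (b j + 1 / real S) powr (1 / q)) + 2 * (\<epsilon> * (\<Sum>j<S. b j)))"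
      by (simp add: sum_distrib_left sum.distrib algebra_simps)
    also have "\<dots> \<le> real n * (2 * \<alpha> powr (1 - 1 / s) * (2 * real S powr (1 - 1 / q)) + 2 * (\<epsilon> * 1))"
      using q b0 b1 S by (intro mult_left_mono add_mono sum_powr_shift_le) (auto simp: \<epsilon>0)
    finally show ?thesis by (simp add: algebra_simps)
  qed
  ultimately show ?thesis using n by (simp add: divide_le_eq \<alpha>_def \<epsilon>_def)
qed

section \<open>Averaging over the random string and the asymptotic bound\<close>

text \<open>A bound for every fixed random string survives averaging. \<open>R\<close> may have
  infinite support, hence the nonnegative integral.\<close>

lemma prob_pair_pmf_le:
  assumes "B \<ge> 0" "\<And>r. r \<in> set_pmf R \<Longrightarrow> measure_pmf.prob I {x. (r, x) \<in> A} \<le> B"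
  shows "measure_pmf.prob (pair_pmf R I) A \<le> B"
proof -
  have pair: "pair_pmf R I = bind_pmf R (\<lambda>r. map_pmf (Pair r) I)"
    by (simp add: pair_pmf_def map_pmf_def)
  have "emeasure (pair_pmf R I) A = (\<integral>\<^sup>+ r. emeasure (measure_pmf I) {x. (r, x) \<in> A} \<partial>R)"
    unfolding pair by (simp add: vimage_def)
  also have "\<dots> \<le> (\<integral>\<^sup>+ r. ennreal B \<partial>R)"
    using assms by (intro nn_integral_mono_AE) (auto simp: AE_measure_pmf_iff measure_pmf.emeasure_eq_measure)
  also have "\<dots> = ennreal B" by simp
  finally show ?thesis using assms by (simp add: measure_pmf.emeasure_eq_measure)
qed

text \<open>Since \<open>ln n\<close> is eventually at least 1, \<open>d n\<close> eventually
  exceeds every fixed \<open>N\<close>.\<close>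

lemma eventually_noise_power_small:
  fixes d :: "nat \<Rightarrow> nat" and x e :: real
  assumes "filterlim (\<lambda>n. real (d n) / ln (real n)) at_top sequentially"
    and x: "0 \<le> x" "x < 1" and e: "e > 0"
  shows "eventually (\<lambda>n. x ^ d n \<le> e) sequentially"
proof -
  obtain N where N: "x ^ N < e" using real_arch_pow_inv[OF e x(2)] by blast
  have "eventually (\<lambda>n. real N \<le> real (d n) / ln (real n)) sequentially"
    using assms(1) by (simp add: filterlim_at_top)
  moreover have "eventually (\<lambda>n. ln (real n) \<ge> 1) sequentially" by real_asymp
  ultimately show ?thesis
  proof eventually_elim
    case (elim n)
    then have "real N * 1 \<le> real N * ln (real n)" by (intro mult_left_mono) auto
    also have "\<dots> \<le> real (d n)" using elim by (simp add: field_simps)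
    finally have "x ^ d n \<le> x ^ N" using x by (intro power_decreasing) auto
    then show ?case using N by simp
  qed
qed

theorem theorem1p3:
  fixes c :: real
    and d w S :: "nat \<Rightarrow> nat"
    and R :: "nat \<Rightarrow> 'r pmf"
    and tbl :: "nat \<Rightarrow> 'r \<Rightarrow> dataset \<Rightarrow> nat \<Rightarrow> nat"
    and prb :: "nat \<Rightarrow> 'r \<Rightarrow> point \<Rightarrow> nat"
    and ans :: "nat \<Rightarrow> 'r \<Rightarrow> point \<Rightarrow> nat \<Rightarrow> point"
  assumes c_gt: "c > 1"
    and d_large: "filterlim (\<lambda>n. real (d n) / ln (real n)) at_top sequentially"
    and w_small: "\<And>\<delta>. \<delta> > 0 \<Longrightarrow> eventually (\<lambda>n. real (w n) \<le> real n powr \<delta>) sequentially"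
    and ds: "\<And>n. n \<ge> 1 \<Longrightarrow> one_probe_ds (R n) (S n) (w n) (tbl n) (prb n)"
    and success: "\<And>n. n \<ge> 1 \<Longrightarrow>
       success_prob (R n) (tbl n) (prb n) (ans n) (hamming_instance n c (d n)) \<ge> 2 / 3"
  shows "\<And>\<delta>. \<delta> > 0 \<Longrightarrow>
    eventually (\<lambda>n. real (S n) \<ge> real n powr ((c / (c - 1))^2 - \<delta>)) sequentially"
proof -
  fix \<delta> :: real assume \<delta>: "\<delta> > 0"
  define \<sigma> where "\<sigma> = (1 - 1 / c)\<^sup>2"
  have "0 < 1 - 1 / c" "1 - 1 / c < 1" using c_gt by auto
  then have \<sigma>: "0 < \<sigma>" "\<sigma> < 1" by (auto simp: \<sigma>_def power_less_one_iff)
  have target: "(c / (c - 1))^2 = 1 / \<sigma>"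
    using c_gt by (simp add: \<sigma>_def field_simps power_divide)
  \<comment> \<open>\<open>x\<close> is the reciprocal of \<open>s - 1\<close>, large enough to
    bring \<kappa> within \<open>\<delta> / 3\<close> of \<open>1 / \<sigma>\<close>.\<close>
  define x where "x = 1 + 3 / (\<sigma> * \<delta>)"
  have x: "x \<ge> 1" using \<sigma> \<delta> by (simp add: x_def)
  define s where "s = 1 + 1 / x"
  define q where "q = 1 + \<sigma> / x"
  have q: "1 < q" "q \<le> s" "s \<le> 2" "(1 - 1 / c)\<^sup>2 * (s - 1) = q - 1"
    using x \<sigma> unfolding \<sigma>_def[symmetric] by (auto simp: q_def s_def field_simps)
  \<comment> \<open>Solving the success bound for \<open>S n\<close> yields a constant times
    \<open>n / (w n + 1)\<close> to the power \<kappa>.\<close>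
  define \<kappa> where "\<kappa> = (1 - 1 / s) / (1 - 1 / q)"
  \<comment> \<open>Words of \<open>n powr \<eta>\<close> bits lower the exponent by
    \<open>\<eta> * \<kappa>\<close>, at most the second third of \<delta>. The last third absorbs
    the constant \<open>C\<close>.\<close>
  define \<eta> where "\<eta> = \<sigma> * \<delta> / 3"
  have B: "0 < 1 - 1 / q" using q by simp
  have \<kappa>: "\<kappa> = (x + \<sigma>) / (\<sigma> * (1 + x))"
  proof -
    have "1 - 1 / s = 1 / (1 + x)" "1 - 1 / q = \<sigma> / (x + \<sigma>)"
      using x \<sigma> by (auto simp: s_def q_def field_simps)
    then show ?thesis by (simp add: \<kappa>_def)
  qed
  have \<kappa>_le: "\<kappa> \<le> 1 / \<sigma>" 
  proof -
    have "(x + \<sigma>) / (1 + x) / \<sigma> \<le> 1 / \<sigma>" using x \<sigma> by (intro divide_right_mono) auto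
    then show ?thesis by (simp add: \<kappa> mult.commute)
  qed
  have \<kappa>0: "\<kappa> \<ge> 0" unfolding \<kappa> using x \<sigma> by simp
  have \<kappa>_ge: "\<kappa> \<ge> 1 / \<sigma> - \<delta> / 3"
  proof -
    have eq: "1 / \<sigma> - \<kappa> = ((1 + x) - (x + \<sigma>)) / (\<sigma> * (1 + x))"
      unfolding \<kappa> diff_divide_distrib[of "1 + x"] using x \<sigma> by simp
    have "1 / \<sigma> - \<kappa> = (1 - \<sigma>) / (\<sigma> * (1 + x))" unfolding eq by simp
    also have "\<dots> \<le> 1 / (\<sigma> * (3 / (\<sigma> * \<delta>)))"
      using x \<sigma> \<delta> by (intro frac_le mult_left_mono mult_pos_pos) (auto simp: x_def)
    also have "\<dots> = \<delta> / 3" using \<sigma> \<delta> by simp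
    finally show ?thesis by simp
  qed
  have exponent: "1 / \<sigma> - 2 * \<delta> / 3 \<le> (1 - \<eta>) * \<kappa>"
  proof -
    have "\<eta> * \<kappa> \<le> \<eta> * (1 / \<sigma>)" using \<kappa>_le \<sigma> \<delta> by (intro mult_left_mono) (auto simp: \<eta>_def)
    also have "\<dots> = \<delta> / 3" using \<sigma> by (simp add: \<eta>_def)
    finally show ?thesis using \<kappa>_ge by (simp add: algebra_simps)
  qed
  define C where "C = (1 / 8) powr (1 / (1 - 1 / q)) * 2 powr (- \<kappa>)"
  have C: "C > 0" by (simp add: C_def)
  \<comment> \<open>With 1/12 the recovery term is at most 1/6, so success 2/3 leaves 1/2 for the
    term with factor 4, which gives the 1/8 below.\<close>
  have "eventually (\<lambda>n. (1 - 1 / (2 * c)) ^ d n \<le> 1 / 12) sequentially"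
    using c_gt by (intro eventually_noise_power_small[OF d_large]) auto
  moreover have "eventually (\<lambda>n. real (w n) \<le> real n powr \<eta>) sequentially"
    using \<sigma> \<delta> by (intro w_small) (simp add: \<eta>_def)
  moreover have "eventually (\<lambda>n. C * real n powr (\<delta> / 3) \<ge> 1) sequentially"
    using C \<delta> by real_asymp
  moreover have "eventually (\<lambda>n. n \<ge> (1 :: nat)) sequentially" by (rule eventually_ge_at_top)
  ultimately show "eventually (\<lambda>n. real (S n) \<ge> real n powr ((c / (c - 1))^2 - \<delta>)) sequentially"
  proof eventually_elim
    case (elim n)
    define \<alpha> where "\<alpha> = (real (w n) + 1) / real n"
    have \<alpha>: "\<alpha> > 0" using elim by (simp add: \<alpha>_def)
    have n1: "1 \<le> real n" using elim by simp
    have "success_prob (R n) (tbl n) (prb n) (ans n) (hamming_instance n c (d n))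
      \<le> 2 * (1 - 1 / (2 * c)) ^ d n + 4 * \<alpha> powr (1 - 1 / s) * real (S n) powr (1 - 1 / q)"
      unfolding success_prob_def
    proof (rule prob_pair_pmf_le)
      show "0 \<le> 2 * (1 - 1 / (2 * c)) ^ d n + 4 * \<alpha> powr (1 - 1 / s) * real (S n) powr (1 - 1 / q)"
        using c_gt by simp
      fix r assume "r \<in> set_pmf (R n)"
      then have "\<And>x. prb n r x < S n" "\<And>P j. tbl n r P j < 2 ^ w n"
        using ds[of n] elim by (auto simp: one_probe_ds_def)
      then show "measure_pmf.prob (hamming_instance n c (d n))
         {y. (r, y) \<in> {(r, P, i, q). ans n r q (tbl n r P (prb n r q)) = P i}}
        \<le> 2 * (1 - 1 / (2 * c)) ^ d n + 4 * \<alpha> powr (1 - 1 / s) * real (S n) powr (1 - 1 / q)"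
        using deterministic_success_le[of n c q s "prb n r" "S n" "tbl n r" "w n" "d n" "ans n r"] elim c_gt q
        by (simp add: \<alpha>_def)
    qed
    with success[of n] elim have "1 / 8 \<le> \<alpha> powr (1 - 1 / s) * real (S n) powr (1 - 1 / q)" by simp
    then have "(1 / 8) powr (1 / (1 - 1 / q)) \<le> (\<alpha> powr (1 - 1 / s) * real (S n) powr (1 - 1 / q)) powr (1 / (1 - 1 / q))"
      using B by (intro powr_mono2) auto
    also have "\<dots> = \<alpha> powr \<kappa> * real (S n)"
    proof -
      have "(1 - 1 / q) * (1 / (1 - 1 / q)) = 1" "(1 - 1 / s) * (1 / (1 - 1 / q)) = \<kappa>"
        using B by (auto simp: \<kappa>_def)
      then show ?thesis by (subst powr_mult) (simp_all only: powr_powr, auto)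
    qed
    finally have "(1 / 8) powr (1 / (1 - 1 / q)) * \<alpha> powr (- \<kappa>) \<le> \<alpha> powr \<kappa> * real (S n) * \<alpha> powr (- \<kappa>)"
      by (rule mult_right_mono) simp
    also have "\<dots> = real (S n)" using \<alpha> by (simp add: powr_minus)
    finally have S: "(1 / 8) powr (1 / (1 - 1 / q)) * \<alpha> powr (- \<kappa>) \<le> real (S n)" .
    \<comment> \<open>The 2 covers the extra 1 in \<open>w n + 1\<close>, as
      \<open>n powr \<eta>\<close> is at least 1; it reappears in \<open>C\<close> as
      \<open>2 powr (- \<kappa>)\<close>.\<close>
    have "\<alpha> \<le> 2 * real n powr (\<eta> - 1)"
    proof -
      have "real (w n) + 1 \<le> 2 * real n powr \<eta>"
        using elim n1 ge_one_powr_ge_zero[of "real n" \<eta>] \<sigma> \<delta> by (simp add: \<eta>_def)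
      then show ?thesis using n1 by (simp add: \<alpha>_def powr_diff divide_right_mono)
    qed
    then have "(2 * real n powr (\<eta> - 1)) powr (- \<kappa>) \<le> \<alpha> powr (- \<kappa>)"
      using \<alpha> \<kappa>0 by (intro powr_mono2') auto
    also have "(2 * real n powr (\<eta> - 1)) powr (- \<kappa>) = 2 powr (- \<kappa>) * real n powr ((1 - \<eta>) * \<kappa>)"
      by (simp add: powr_mult powr_powr algebra_simps)
    finally have "2 powr (- \<kappa>) * real n powr ((1 - \<eta>) * \<kappa>) \<le> \<alpha> powr (- \<kappa>)" .
    then have "C * real n powr ((1 - \<eta>) * \<kappa>) \<le> (1 / 8) powr (1 / (1 - 1 / q)) * \<alpha> powr (- \<kappa>)"
      unfolding C_def mult.assoc by (intro mult_left_mono) auto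
    with S have S': "C * real n powr ((1 - \<eta>) * \<kappa>) \<le> real (S n)" by linarith
    have "real n powr (1 / \<sigma> - \<delta>) \<le> (C * real n powr (\<delta> / 3)) * real n powr (1 / \<sigma> - \<delta>)"
      using mult_right_mono[of 1 "C * real n powr (\<delta> / 3)" "real n powr (1 / \<sigma> - \<delta>)"] elim by simp
    also have "\<dots> = C * real n powr (1 / \<sigma> - 2 * \<delta> / 3)"
      by (simp add: mult.assoc flip: powr_add)
    also have "\<dots> \<le> C * real n powr ((1 - \<eta>) * \<kappa>)"
      using C n1 exponent by (intro mult_left_mono powr_mono) auto
    also note S'
    finally show ?case unfolding target .
  qed
qed

end
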